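(* Let $G$ be a finite group and let $n\geq 3$ be an integer. Then $\mathscr{I}_c(G)\cong C_n$ if and only if $n=3$ and $G\cong \mathbb{Z}_{p^4}$ for some prime $p$.
   Context: For a group $G$, the intersection graph of cyclic subgroups of $G$, denoted $\mathscr{I}_c(G)$, is the simple graph whose vertices are all the proper cyclic subgroups of $G$ (cyclic subgroups different from $G$ and from the trivial subgroup), two distinct vertices being adjacent if and only if their intersection is a non-trivial subgroup. $C_n$ denotes the cycle with $n$ edges. $\mathbb{Z}_m$ is the cyclic group of order $m$. *)

theory Defs
  imports
    "HOL-Algebra.Elementary_Groups"
    "HOL-Computational_Algebra.Primes"
    "Graph_Theory.Pair_Digraph"
    "Graph_Theory.Digraph_Isomorphism"
begin

text \<open>
  Following \<^theory>\<open>Graph_Theory.Digraph\<close>, a simple graph is a symmetric, loop-free digraph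
  without parallel arcs: each edge is represented by its two opposite arcs. For such graphs
  \<^const>\<open>digraph_iso\<close> is the usual isomorphism of simple graphs.
\<close>

definition proper_cyclic_subgroups :: "('a, 'b) monoid_scheme \<Rightarrow> 'a set set" where
  "proper_cyclic_subgroups G =
    {H. subgroup H G \<and> cyclic_group (G\<lparr>carrier := H\<rparr>) \<and> H \<noteq> carrier G \<and> H \<noteq> {\<one>\<^bsub>G\<^esub>}}"

definition cyclic_intersection_graph :: "('a, 'b) monoid_scheme \<Rightarrow> 'a set pair_pre_digraph" where
  "cyclic_intersection_graph G =
    \<lparr>pverts = proper_cyclic_subgroups G,
     parcs = {(H, K). H \<in> proper_cyclic_subgroups G \<and> K \<in> proper_cyclic_subgroups G \<and>
                      H \<noteq> K \<and> H \<inter> K \<noteq> {\<one>\<^bsub>G\<^esub>}}\<rparr>"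

text \<open>The cycle with \<open>n\<close> edges, for \<open>n \<ge> 3\<close>; smaller \<open>n\<close> give degenerate graphs.\<close>

definition cycle_graph :: "nat \<Rightarrow> nat pair_pre_digraph" where
  "cycle_graph n =
    \<lparr>pverts = {..<n},
     parcs = {(i, j). i < n \<and> j < n \<and> (j = Suc i mod n \<or> i = Suc j mod n)}\<rparr>"

lemma pair_graph_cyclic_intersection_graph:
  assumes "finite (carrier G)"
  shows "pair_graph (cyclic_intersection_graph G)"
proof -
  have "finite (proper_cyclic_subgroups G)"
    by (rule finite_subset[of _ "Pow (carrier G)"])
      (use assms in \<open>auto simp: proper_cyclic_subgroups_def dest: subgroup.subset\<close>)
  then show ?thesis
    by unfold_locales
      (auto simp: cyclic_intersection_graph_def symmetric_def sym_def Int_commute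
        intro: finite_subset[of _ "proper_cyclic_subgroups G \<times> proper_cyclic_subgroups G"])
qed

lemma pair_graph_cycle_graph:
  assumes "n \<ge> 3"
  shows "pair_graph (cycle_graph n)"
proof -
  have "Suc i mod n \<noteq> i" if "i < n" for i
    using assms that by (auto simp: mod_Suc)
  then show ?thesis
    by unfold_locales
      (auto simp: cycle_graph_def symmetric_def sym_def dest: sym
        intro: finite_subset[of _ "{..<n} \<times> {..<n}"])
qed

end

theory Submission
  imports Defs "HOL-Algebra.Multiplicative_Group"
begin

text \<open>
  The vertices of the graph are partially ordered by inclusion. If \<open>P\<close> is a minimal one, then every
  vertex meeting \<open>P\<close> non-trivially contains \<open>P\<close>, because the cyclic group generated by a non-trivial
  common element is a vertex below \<open>P\<close>. Hence any two neighbours of \<open>P\<close> are equal or adjacent, and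
  the only cycle having such a vertex is the triangle (\<open>cycle_graph_clique_neighbourhood\<close>). So
  \<open>n = 3\<close>, and besides \<open>P\<close> there are just two vertices \<open>A\<close> and \<open>B\<close>, both of which contain \<open>P\<close>.

  Such a group is cyclic: otherwise each element lies in the cyclic group it generates, which is
  trivial or a vertex, so that \<open>G = A \<union> B\<close>; but no group is the union of two proper subgroups.

  The subgroups of a cyclic group of order \<open>m\<close> are the sets of solutions of \<open>x\<^sup>d = 1\<close>, one for each
  divisor \<open>d\<close> of \<open>m\<close>, and the solution sets for \<open>d\<close> and \<open>e\<close> meet in the one for \<open>gcd d e\<close>. The
  graph is therefore a triangle if and only if \<open>m\<close> has exactly three divisors other than \<open>1\<close> and \<open>m\<close>
  and no two of these are coprime. The latter forces \<open>m\<close> to be a power of a prime \<open>p\<close>, and the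
  former forces the exponent to be four.
\<close>

section \<open>Isomorphism with a cycle graph\<close>

text \<open>
  An arc is the pair of its ends, so the arc map of an isomorphism is determined by the vertex map.
\<close>

lemma digraph_iso_with_proj_iff:
  assumes "pair_wf_digraph A" "pair_wf_digraph B"
  shows "digraph_iso (with_proj A) (with_proj B) \<longleftrightarrow>
    (\<exists>f. bij_betw f (pverts A) (pverts B) \<and>
      (\<forall>u\<in>pverts A. \<forall>v\<in>pverts A. (u, v) \<in> parcs A \<longleftrightarrow> (f u, f v) \<in> parcs B))"
    (is "?L \<longleftrightarrow> ?R")
proof -
  interpret A: pair_wf_digraph A by fact
  interpret B: pair_wf_digraph B by fact
  show ?thesis
  proof
    assume ?L
    then obtain h where h: "pre_digraph.digraph_isomorphism (with_proj A) h"
      and B: "with_proj B = app_iso h (with_proj A)"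
      by (auto simp: digraph_iso_def)
    define f where "f = iso_verts h"
    have verts: "pverts B = f ` pverts A" and arcs: "parcs B = iso_arcs h ` parcs A"
      and ends: "iso_tail h = fst" "iso_head h = snd"
      using arg_cong[OF B, of verts] arg_cong[OF B, of arcs]
        arg_cong[OF B, of tail] arg_cong[OF B, of head] by (simp_all add: f_def)
    have inj: "inj_on f (pverts A)"
      using h by (simp add: f_def pre_digraph.digraph_isomorphism_def)
    have img: "iso_arcs h a = (f (fst a), f (snd a))" if "a \<in> parcs A" for a
      using h that ends by (auto simp: f_def pre_digraph.digraph_isomorphism_def prod_eq_iff)
    have "(u, v) \<in> parcs A \<longleftrightarrow> (f u, f v) \<in> parcs B" if "u \<in> pverts A" "v \<in> pverts A" for u v
    proof
      assume "(u, v) \<in> parcs A"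
      then show "(f u, f v) \<in> parcs B" using img[of "(u, v)"] unfolding arcs by force
    next
      assume "(f u, f v) \<in> parcs B"
      then obtain a where a: "a \<in> parcs A" "(f u, f v) = iso_arcs h a" unfolding arcs by blast
      then have "fst a = u" "snd a = v"
        using img[OF a(1)] that A.in_arcsD1[of "fst a" "snd a"] A.in_arcsD2[of "fst a" "snd a"] inj
        by (auto dest: inj_onD)
      with a(1) show "(u, v) \<in> parcs A" by (cases a) auto
    qed
    with inj verts show ?R by (auto simp: bij_betw_def)
  next
    assume ?R
    then obtain f where f: "bij_betw f (pverts A) (pverts B)"
      and adj: "\<forall>u\<in>pverts A. \<forall>v\<in>pverts A. (u, v) \<in> parcs A \<longleftrightarrow> (f u, f v) \<in> parcs B"
      by blast
    let ?h = "\<lparr>iso_verts = f, iso_arcs = map_prod f f, iso_head = snd, iso_tail = fst\<rparr>"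
    have ends: "u \<in> pverts A" "v \<in> pverts A" if "(u, v) \<in> parcs A" for u v
      using that by (fact A.in_arcsD1, fact A.in_arcsD2)
    have "inj_on (map_prod f f) (pverts A \<times> pverts A)"
      using f by (simp add: bij_betw_def map_prod_inj_on)
    then have inj: "inj_on (map_prod f f) (parcs A)"
      by (rule inj_on_subset) (rule subrelI, simp add: ends)
    have "map_prod f f ` parcs A \<subseteq> parcs B"
    proof (rule image_subsetI)
      fix a assume "a \<in> parcs A"
      then have "(fst a, snd a) \<in> parcs A" by simp
      then have "(f (fst a), f (snd a)) \<in> parcs B" using adj ends by metis
      then show "map_prod f f a \<in> parcs B" by (simp add: map_prod_def split_beta)
    qed
    moreover have "parcs B \<subseteq> map_prod f f ` parcs A"
    proof (rule subrelI)
      fix x y assume xy: "(x, y) \<in> parcs B"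
      have "x \<in> pverts B" "y \<in> pverts B"
        using B.in_arcsD1[OF xy] B.in_arcsD2[OF xy] .
      then obtain u v where uv: "u \<in> pverts A" "v \<in> pverts A" and "x = f u" "y = f v"
        using f by (metis bij_betw_imp_surj_on imageE)
      moreover from this have "(u, v) \<in> parcs A" using adj xy by blast
      ultimately show "(x, y) \<in> map_prod f f ` parcs A" by (simp add: rev_image_eqI)
    qed
    ultimately have "with_proj B = app_iso ?h (with_proj A)"
      using f by (simp add: with_proj_def app_iso_def bij_betw_def subset_antisym)
    moreover have "pre_digraph.digraph_isomorphism (with_proj A) ?h"
      using f inj A.wf_digraph_axioms by (simp add: pre_digraph.digraph_isomorphism_def bij_betw_def)
    ultimately show ?L unfolding digraph_iso_def by blast
  qed
qed

text \<open>
  The two neighbours \<open>i + 1\<close> and \<open>i - 1\<close> of \<open>i\<close> differ by \<open>2\<close>, which is congruent to \<open>1\<close> or \<open>-1\<close>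
  only modulo \<open>3\<close>.
\<close>

lemma cycle_graph_clique_neighbourhood:
  assumes n: "n \<ge> 3" and i: "i < n"
    and clique: "\<And>j k. (i, j) \<in> parcs (cycle_graph n) \<Longrightarrow> (i, k) \<in> parcs (cycle_graph n) \<Longrightarrow>
      j \<noteq> k \<Longrightarrow> (j, k) \<in> parcs (cycle_graph n)"
  shows "n = 3"
proof -
  define j where "j = (if Suc i = n then 0 else Suc i)"
  define k where "k = (if i = 0 then n - 1 else i - 1)"
  have "(i, j) \<in> parcs (cycle_graph n)" "(i, k) \<in> parcs (cycle_graph n)" "j \<noteq> k"
    using n i by (auto simp: j_def k_def cycle_graph_def mod_Suc)
  then have "(j, k) \<in> parcs (cycle_graph n)" by (rule clique)
  then show ?thesis
    using n i by (auto simp: j_def k_def cycle_graph_def mod_Suc split: if_splits)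
qed

lemma digraph_iso_triangle_iff:
  assumes "pair_graph A"
  shows "digraph_iso (with_proj A) (with_proj (cycle_graph 3)) \<longleftrightarrow>
    card (pverts A) = 3 \<and> (\<forall>u\<in>pverts A. \<forall>v\<in>pverts A. u \<noteq> v \<longrightarrow> (u, v) \<in> parcs A)"
    (is "?L \<longleftrightarrow> ?R")
proof -
  interpret A: pair_graph A by fact
  interpret C: pair_graph "cycle_graph 3" by (rule pair_graph_cycle_graph) simp
  have verts: "pverts (cycle_graph 3) = {..<3}"
    and arcs: "\<And>i j. (i, j) \<in> parcs (cycle_graph 3) \<longleftrightarrow> i < 3 \<and> j < 3 \<and> i \<noteq> j"
    by (auto simp: cycle_graph_def mod_Suc)
  note iso_iff = digraph_iso_with_proj_iff[OF A.pair_wf_digraph_axioms C.pair_wf_digraph_axioms]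
  show ?thesis
  proof
    assume ?L
    then obtain f where f: "bij_betw f (pverts A) {..<3::nat}"
      and adj: "\<forall>u\<in>pverts A. \<forall>v\<in>pverts A. (u, v) \<in> parcs A \<longleftrightarrow> f u < 3 \<and> f v < 3 \<and> f u \<noteq> f v"
      unfolding iso_iff verts arcs by blast
    have "card (pverts A) = 3" using bij_betw_same_card[OF f] by simp
    moreover have "(u, v) \<in> parcs A" if "u \<in> pverts A" "v \<in> pverts A" "u \<noteq> v" for u v
      using f adj that by (auto simp: bij_betw_def inj_on_def)
    ultimately show ?R by blast
  next
    assume R: ?R
    then obtain f where f: "bij_betw f (pverts A) {..<3::nat}"
      by (metis A.pair_finite_verts card_lessThan finite_lessThan finite_same_card_bij)
    have "(u, v) \<in> parcs A \<longleftrightarrow> f u < 3 \<and> f v < 3 \<and> f u \<noteq> f v"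
      if "u \<in> pverts A" "v \<in> pverts A" for u v
      using R f that A.pair_no_loops[of "(u, v)"] by (auto simp: bij_betw_def inj_on_def)
    with f show ?L unfolding iso_iff verts arcs by blast
  qed
qed

section \<open>Cyclic subgroups of a finite group\<close>

context group
begin

lemma cyclic_subgroup_iff:
  "subgroup H G \<and> cyclic_group (G\<lparr>carrier := H\<rparr>) \<longleftrightarrow> (\<exists>x\<in>carrier G. H = generate G {x})"
proof
  assume H: "subgroup H G \<and> cyclic_group (G\<lparr>carrier := H\<rparr>)"
  then obtain x where x: "x \<in> H" "H = range (\<lambda>n::int. x [^]\<^bsub>G\<lparr>carrier := H\<rparr>\<^esub> n)"
    using group.cyclic_group[OF subgroup_imp_group, of H] by auto
  have "H = range (\<lambda>n::int. x [^] n)"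
    using x(2) int_pow_consistent[OF conjunct1[OF H] x(1)] by simp
  moreover have "x \<in> carrier G" using H x(1) subgroup.mem_carrier by fast
  ultimately show "\<exists>x\<in>carrier G. H = generate G {x}"
    using generate_pow by (auto simp: full_SetCompr_eq)
next
  assume "\<exists>x\<in>carrier G. H = generate G {x}"
  then obtain x where x: "x \<in> carrier G" and H: "H = generate G {x}" by blast
  then have sub: "subgroup H G" by (simp add: generate_is_subgroup)
  have xH: "x \<in> H" unfolding H by (simp add: generate.incl)
  have "H = range (\<lambda>n::int. x [^] n)"
    unfolding H generate_pow[OF x] by (simp add: full_SetCompr_eq)
  also have "\<dots> = range (\<lambda>n::int. x [^]\<^bsub>G\<lparr>carrier := H\<rparr>\<^esub> n)"
    by (rule image_cong[OF refl]) (rule int_pow_consistent[OF sub xH])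
  finally have "cyclic_group (G\<lparr>carrier := H\<rparr>)"
    unfolding group.cyclic_group[OF subgroup_imp_group[OF sub]] using xH by (intro bexI[of _ x]) simp_all
  with sub show "subgroup H G \<and> cyclic_group (G\<lparr>carrier := H\<rparr>)" by blast
qed

lemma proper_cyclic_subgroups_eq_generate:
  "proper_cyclic_subgroups G =
    {H. (\<exists>x\<in>carrier G. H = generate G {x}) \<and> H \<noteq> carrier G \<and> H \<noteq> {\<one>}}"
  by (simp only: proper_cyclic_subgroups_def cyclic_subgroup_iff[symmetric] conj_assoc)

lemma cyclic_group_iff_generate: "cyclic_group G \<longleftrightarrow> (\<exists>x\<in>carrier G. generate G {x} = carrier G)"
proof -
  have "G\<lparr>carrier := carrier G\<rparr> = G" by simp
  then show ?thesis using cyclic_subgroup_iff[of "carrier G"] subgroup_self by metis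
qed

text \<open>
  A non-trivial element of \<open>P \<inter> K\<close> generates a vertex contained in \<open>P\<close>, which by minimality is all
  of \<open>P\<close>.
\<close>

lemma minimal_proper_cyclic_subgroup_subset:
  assumes P: "P \<in> proper_cyclic_subgroups G" and K: "K \<in> proper_cyclic_subgroups G"
    and min: "\<And>H. H \<in> proper_cyclic_subgroups G \<Longrightarrow> H \<subseteq> P \<Longrightarrow> H = P"
    and PK: "P \<inter> K \<noteq> {\<one>}"
  shows "P \<subseteq> K"
proof -
  have sub: "subgroup P G" "subgroup K G"
    using P K by (auto simp: proper_cyclic_subgroups_def)
  then obtain x where x: "x \<in> P" "x \<in> K" "x \<noteq> \<one>"
    using PK subgroup.one_closed by blast
  have "generate G {x} \<subseteq> P" "generate G {x} \<subseteq> K"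
    using sub x generate_subgroup_incl by auto
  moreover have "x \<in> carrier G" using sub x subgroup.mem_carrier by fast
  moreover have "x \<in> generate G {x}" by (simp add: generate.incl)
  moreover have "P \<subset> carrier G"
    using P subgroup.subset by (auto simp: proper_cyclic_subgroups_def)
  ultimately have "generate G {x} = P"
    using min[of "generate G {x}"] x by (auto simp: proper_cyclic_subgroups_eq_generate)
  then show ?thesis using \<open>generate G {x} \<subseteq> K\<close> by simp
qed

lemma carrier_neq_Un_subgroups:
  assumes A: "subgroup A G" "A \<noteq> carrier G" and B: "subgroup B G" "B \<noteq> carrier G"
  shows "carrier G \<noteq> A \<union> B"
proof
  assume eq: "carrier G = A \<union> B"
  obtain a b where a: "a \<in> B" "a \<notin> A" and b: "b \<in> A" "b \<notin> B"
    using A B eq by blast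
  have car: "a \<in> carrier G" "b \<in> carrier G" using a b eq by auto
  \<comment> \<open>The product \<open>ab\<close> can lie neither in \<open>A\<close>, since \<open>a = (ab)b\<^sup>-\<^sup>1\<close>, nor in \<open>B\<close>, since \<open>b = a\<^sup>-\<^sup>1(ab)\<close>.\<close>
  have "a \<otimes> b \<in> A \<union> B" using car eq by blast
  then show False
  proof
    assume "a \<otimes> b \<in> A"
    then have "(a \<otimes> b) \<otimes> inv b \<in> A"
      using b A subgroup.m_closed subgroup.m_inv_closed by metis
    with a car show False by (simp add: m_assoc)
  next
    assume "a \<otimes> b \<in> B"
    then have "inv a \<otimes> (a \<otimes> b) \<in> B"
      using a B subgroup.m_closed subgroup.m_inv_closed by metis
    with b car show False by (simp flip: m_assoc)
  qed
qed

text \<open>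
  A group that is not cyclic is the union of its proper cyclic subgroups. When \<open>P\<close> lies inside the
  other two, this is a union of only two subgroups.
\<close>

lemma cyclic_group_if_three_proper_cyclic_subgroups:
  assumes three: "card (proper_cyclic_subgroups G) = 3"
    and P: "P \<in> proper_cyclic_subgroups G"
    and least: "\<And>H. H \<in> proper_cyclic_subgroups G \<Longrightarrow> P \<subseteq> H"
  shows "cyclic_group G"
proof (rule ccontr)
  assume noncyclic: "\<not> cyclic_group G"
  have fin: "finite (proper_cyclic_subgroups G)" using three card.infinite by fastforce
  have "card (proper_cyclic_subgroups G - {P}) = 2"
    using three P fin by (simp add: card_Diff_singleton)
  then obtain A B where AB: "proper_cyclic_subgroups G - {P} = {A, B}"
    by (auto simp: card_2_iff)
  then have A: "A \<in> proper_cyclic_subgroups G" and B: "B \<in> proper_cyclic_subgroups G" by auto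
  then have sub: "subgroup A G" "A \<noteq> carrier G" "subgroup B G" "B \<noteq> carrier G"
    by (auto simp: proper_cyclic_subgroups_def)
  have "carrier G \<subseteq> A \<union> B"
  proof
    fix x assume x: "x \<in> carrier G"
    have gen: "x \<in> generate G {x}" by (simp add: generate.incl)
    show "x \<in> A \<union> B"
    proof (cases "x = \<one>")
      case True
      then show ?thesis using sub subgroup.one_closed by blast
    next
      case False
      then have "generate G {x} \<in> proper_cyclic_subgroups G"
        using x gen noncyclic
        by (auto simp: proper_cyclic_subgroups_eq_generate cyclic_group_iff_generate)
      then have "generate G {x} \<in> {P, A, B}" using AB by blast
      then show ?thesis using gen least[OF A] by blast
    qed
  qed
  moreover have "A \<union> B \<subseteq> carrier G" using sub subgroup.subset by blast
  ultimately show False using carrier_neq_Un_subgroups[of A B] sub by blast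
qed

end

section \<open>Subgroups of finite cyclic groups\<close>

definition torsion :: "('a, 'b) monoid_scheme \<Rightarrow> nat \<Rightarrow> 'a set" where
  "torsion G d = {x \<in> carrier G. x [^]\<^bsub>G\<^esub> d = \<one>\<^bsub>G\<^esub>}"

context group
begin

lemma torsion_Int: "torsion G d \<inter> torsion G e = torsion G (gcd d e)"
  by (auto simp: torsion_def pow_eq_id)

lemma torsion_1: "torsion G 1 = {\<one>}"
  by (auto simp: torsion_def)

lemma torsion_order: "torsion G (order G) = carrier G"
  by (auto simp: torsion_def pow_order_eq_1)

context
  assumes fin: "finite (carrier G)" and cyc: "cyclic_group G"
begin

text \<open>
  If \<open>g\<close> generates \<open>G\<close> and \<open>m\<close> is the order of \<open>G\<close>, then \<open>(g\<^sup>i)\<^sup>d = 1\<close> means that \<open>m\<close> divides \<open>i d\<close>,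
  that is, that \<open>m div d\<close> divides \<open>i\<close>.
\<close>

lemma torsion_eq_generate:
  assumes d: "d dvd order G"
  shows "\<exists>x\<in>carrier G. ord x = d \<and> torsion G d = generate G {x}"
proof -
  obtain g where g: "g \<in> carrier G" and gen: "generate G {g} = carrier G"
    using cyc cyclic_group_iff_generate by blast
  have ordg: "ord g = order G"
    using generate_pow_card[OF g] gen by (simp add: order_def)
  have pos: "order G > 0" using fin order_gt_0_iff_finite by blast
  from d obtain c where c: "order G = d * c" by blast
  have c0: "c > 0" and d0: "d > 0" using pos c by auto
  define x where "x = g [^] c"
  have x: "x \<in> carrier G" using g by (simp add: x_def)
  have ordx: "ord x = d"
    using ord_pow[OF g, of c] c ordg c0 by (simp add: x_def)
  have "y \<in> torsion G d \<longleftrightarrow> y \<in> generate G {x}" for y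
  proof
    assume y: "y \<in> torsion G d"
    then have "y \<in> generate G {g}" using gen by (simp add: torsion_def)
    then obtain i :: nat where i: "y = g [^] i"
      using generate_pow_on_finite_carrier[OF fin g] by blast
    have "g [^] (i * d) = \<one>" using y g by (simp add: torsion_def i nat_pow_pow)
    then have "c * d dvd i * d" using pow_eq_id[OF g] ordg c by (simp add: mult.commute)
    then obtain k where "i = c * k" using d0 by auto
    then have "y = x [^] k" using g by (simp add: i x_def nat_pow_pow)
    then show "y \<in> generate G {x}" using generate_pow_on_finite_carrier[OF fin x] by blast
  next
    assume "y \<in> generate G {x}"
    then obtain k :: nat where k: "y = x [^] k"
      using generate_pow_on_finite_carrier[OF fin x] by blast
    have "x [^] (k * d) = \<one>" using pow_eq_id[OF x] ordx by simp
    then show "y \<in> torsion G d" using x by (simp add: torsion_def k nat_pow_pow)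
  qed
  then show ?thesis using x ordx by blast
qed

lemma card_torsion:
  assumes "d dvd order G"
  shows "card (torsion G d) = d"
  using torsion_eq_generate[OF assms] generate_pow_card by fastforce

lemma torsion_eq_iff:
  assumes "d dvd order G" "e dvd order G"
  shows "torsion G d = torsion G e \<longleftrightarrow> d = e"
  using assms card_torsion by metis

text \<open>
  The powers of \<open>x\<close> already account for all \<open>ord x\<close> solutions of \<open>y\<^sup>d = 1\<close> with \<open>d = ord x\<close>. So a
  cyclic subgroup is determined by its order.
\<close>

lemma generate_eq_torsion:
  assumes x: "x \<in> carrier G"
  shows "generate G {x} = torsion G (ord x)"
proof (rule card_subset_eq)
  show "finite (torsion G (ord x))" using fin by (simp add: torsion_def)
  show "card (generate G {x}) = card (torsion G (ord x))"
    using card_torsion[OF ord_dvd_group_order[OF x]] generate_pow_card[OF x] by simp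
  show "generate G {x} \<subseteq> torsion G (ord x)"
  proof
    fix y assume "y \<in> generate G {x}"
    then obtain k :: nat where k: "y = x [^] k"
      using generate_pow_on_finite_carrier[OF fin x] by blast
    have "x [^] (k * ord x) = \<one>" using pow_eq_id[OF x] by simp
    then show "y \<in> torsion G (ord x)" using x by (simp add: torsion_def k nat_pow_pow)
  qed
qed

lemma proper_cyclic_subgroups_eq_torsion:
  "proper_cyclic_subgroups G = torsion G ` {d. d dvd order G \<and> d \<noteq> 1 \<and> d \<noteq> order G}"
proof -
  have cyclic: "(\<exists>x\<in>carrier G. H = generate G {x}) \<longleftrightarrow> (\<exists>d. d dvd order G \<and> H = torsion G d)" for H
    using torsion_eq_generate generate_eq_torsion ord_dvd_group_order by metis
  have "torsion G d = carrier G \<longleftrightarrow> d = order G" "torsion G d = {\<one>} \<longleftrightarrow> d = 1"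
    if "d dvd order G" for d
    using torsion_eq_iff[OF that] torsion_order torsion_1 by (metis dvd_refl one_dvd)+
  then show ?thesis
    unfolding proper_cyclic_subgroups_eq_generate cyclic by blast
qed

lemma cyclic_group_iso_integer_mod_group: "G \<cong> integer_mod_group (order G)"
proof -
  obtain g where g: "g \<in> carrier G" and gen: "generate G {g} = carrier G"
    using cyc cyclic_group_iff_generate by blast
  let ?m = "order G"
  let ?h = "\<lambda>i::int. g [^] i"
  have ordg: "ord g = ?m"
    using generate_pow_card[OF g] gen by (simp add: order_def)
  have pos: "?m > 0" using fin order_gt_0_iff_finite by blast
  then have car: "carrier (integer_mod_group ?m) = {0..<int ?m}"
    by (simp add: carrier_integer_mod_group)
  have "?h \<in> hom (integer_mod_group ?m) G"
  proof (rule homI)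
    fix i j
    have "g [^] ((i + j) mod int ?m) = g [^] (i + j)"
      using int_pow_eq[OF g] ordg by (simp add: mod_eq_dvd_iff[symmetric])
    then show "?h (i \<otimes>\<^bsub>integer_mod_group ?m\<^esub> j) = ?h i \<otimes> ?h j"
      using g by (simp add: int_pow_mult)
  qed (use g in simp)
  moreover have inj: "inj_on ?h {0..<int ?m}"
  proof (rule inj_onI)
    fix i j assume ij: "i \<in> {0..<int ?m}" "j \<in> {0..<int ?m}" "?h i = ?h j"
    then have "int ?m dvd j - i" using int_pow_eq[OF g] ordg by simp
    then have "j mod int ?m = i mod int ?m" by (simp add: mod_eq_dvd_iff)
    with ij show "i = j" by simp
  qed
  moreover have "?h ` {0..<int ?m} = carrier G"
    using fin g card_image[OF inj] by (intro card_subset_eq) (auto simp: order_def)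
  ultimately have "?h \<in> iso (integer_mod_group ?m) G"
    by (simp add: iso_def bij_betw_def car)
  then show ?thesis
    using group.iso_sym[OF group_integer_mod_group] is_isoI by blast
qed

end

end

lemma cyclic_group_integer_mod_group: "cyclic_group (integer_mod_group m)"
proof -
  interpret group "integer_mod_group m" by simp
  show ?thesis
  proof (cases "m = 0")
    case True
    then show ?thesis by (simp add: integer_mod_group_def)
  next
    case False
    \<comment> \<open>The residue of \<open>1\<close> is a generator also for \<open>m = 1\<close>, where it is \<open>0\<close>.\<close>
    let ?g = "1 mod int m"
    have g: "?g \<in> carrier (integer_mod_group m)"
      using False by (simp add: carrier_integer_mod_group)
    have pow: "?g [^]\<^bsub>integer_mod_group m\<^esub> (k::int) = k mod int m" for k
      by (simp add: int_pow_integer_mod_group mod_mult_right_eq)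
    have "range (\<lambda>k::int. k mod int m) = {0..<int m}"
      using False by (auto simp: image_iff) (metis mod_pos_pos_trivial)
    then show ?thesis
      using False g by (auto simp: cyclic_group pow carrier_integer_mod_group intro!: bexI[of _ ?g])
  qed
qed

lemma iso_integer_mod_group_iff:
  assumes "group G" "finite (carrier G)" "m > 0"
  shows "G \<cong> integer_mod_group m \<longleftrightarrow> cyclic_group G \<and> order G = m"
proof
  assume iso: "G \<cong> integer_mod_group m"
  then have "order G = m"
    using iso_same_card[OF iso] assms(3) by (simp add: order_def carrier_integer_mod_group)
  moreover have "cyclic_group G"
    using isomorphic_group_cyclicity[OF iso assms(1)] cyclic_group_integer_mod_group by simp
  ultimately show "cyclic_group G \<and> order G = m" by blast
next
  assume "cyclic_group G \<and> order G = m"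
  then show "G \<cong> integer_mod_group m"
    using group.cyclic_group_iso_integer_mod_group assms by blast
qed

section \<open>Numbers with three pairwise non-coprime proper divisors\<close>

lemma prime_powerI:
  fixes m p :: nat
  assumes "m > 0" "prime p" and only: "\<And>q. prime q \<Longrightarrow> q dvd m \<Longrightarrow> q = p"
  shows "\<exists>k. m = p ^ k"
proof -
  obtain r where r: "m = p ^ multiplicity p m * r" "\<not> p dvd r"
    using multiplicity_decompose'[of m p] assms by (metis not_prime_unit gr_implies_not0)
  have "r = 1"
  proof (rule ccontr)
    assume "r \<noteq> 1"
    then obtain q where q: "prime q" "q dvd r" using prime_factor_nat by blast
    then have "q dvd m" by (subst r(1)) simp
    then show False using only q r(2) by blast
  qed
  then show ?thesis using r(1) by auto
qed

text \<open>
  If \<open>m\<close> has any divisor besides \<open>1\<close> and \<open>m\<close>, then it is not prime and all its prime divisors are of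
  this kind. Distinct primes being coprime, there can be only one of them. A prime power \<open>p\<^sup>k\<close> has
  the \<open>k - 1\<close> divisors \<open>p\<^sup>i\<close> with \<open>0 < i < k\<close>.
\<close>

lemma three_proper_divisors_iff:
  fixes m :: nat
  assumes "m > 0"
  defines "D \<equiv> {d. d dvd m \<and> d \<noteq> 1 \<and> d \<noteq> m}"
  shows "card D = 3 \<and> (\<forall>d\<in>D. \<forall>e\<in>D. \<not> coprime d e) \<longleftrightarrow> (\<exists>p. prime p \<and> m = p ^ 4)"
proof -
  have D_power: "D = (^) p ` {1..<k}" if p: "prime p" and m: "m = p ^ k" for p k
  proof -
    have "p > 1" using p by (rule prime_gt_1_nat)
    then have inj: "p ^ i = 1 \<longleftrightarrow> i = 0" "p ^ i = p ^ k \<longleftrightarrow> i = k" for i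
      by simp_all
    have "D = (^) p ` {i. i \<le> k \<and> p ^ i \<noteq> 1 \<and> p ^ i \<noteq> p ^ k}"
      unfolding D_def m divides_primepow_nat[OF p]
      by (auto simp only: image_iff mem_Collect_eq bex_simps)
    also have "{i. i \<le> k \<and> p ^ i \<noteq> 1 \<and> p ^ i \<noteq> p ^ k} = {1..<k}"
      unfolding inj by auto
    finally show ?thesis .
  qed
  have card_power: "card ((^) p ` {1..<k}) = k - 1" if "prime p" for p k :: nat
    using prime_gt_1_nat[OF that] by (subst card_image) (auto simp: inj_on_def)
  show ?thesis
  proof
    assume A: "card D = 3 \<and> (\<forall>d\<in>D. \<forall>e\<in>D. \<not> coprime d e)"
    have "D \<noteq> {}" using A by auto
    then have "m \<noteq> 1" by (auto simp: D_def)
    then obtain p where p: "prime p" "p dvd m" using prime_factor_nat by blast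
    have "\<not> prime m" using \<open>D \<noteq> {}\<close> by (auto simp: D_def prime_nat_iff)
    then have in_D: "q \<in> D" if "prime q" "q dvd m" for q
      using that by (auto simp: D_def)
    then have "q = p" if "prime q" "q dvd m" for q
      using A p that primes_coprime by blast
    then obtain k where k: "m = p ^ k" using prime_powerI assms(1) p by blast
    have "k - 1 = 3" using A D_power[OF p(1) k] card_power[OF p(1)] by metis
    then have "k = 4" by simp
    with p(1) k show "\<exists>p. prime p \<and> m = p ^ 4" by blast
  next
    assume "\<exists>p. prime p \<and> m = p ^ 4"
    then obtain p where p: "prime p" and m: "m = p ^ 4" by blast
    have "\<not> coprime d e" if "d \<in> D" "e \<in> D" for d e
      using that p unfolding D_power[OF p m] by (auto simp: prime_gt_0_nat)
    then show "card D = 3 \<and> (\<forall>d\<in>D. \<forall>e\<in>D. \<not> coprime d e)"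
      using D_power[OF p m] card_power[OF p, of 4] by auto
  qed
qed

section \<open>Groups whose graph is a cycle\<close>

lemma cyclic_intersection_graph_triangle_iff:
  assumes "group G" "finite (carrier G)"
  shows "digraph_iso (with_proj (cyclic_intersection_graph G)) (with_proj (cycle_graph 3)) \<longleftrightarrow>
    card (proper_cyclic_subgroups G) = 3 \<and>
    (\<forall>H\<in>proper_cyclic_subgroups G. \<forall>K\<in>proper_cyclic_subgroups G. H \<inter> K \<noteq> {\<one>\<^bsub>G\<^esub>})"
proof -
  \<comment> \<open>Equal vertices may be included, since a vertex meets itself non-trivially.\<close>
  have "(\<forall>H\<in>proper_cyclic_subgroups G. \<forall>K\<in>proper_cyclic_subgroups G. H \<inter> K \<noteq> {\<one>\<^bsub>G\<^esub>}) \<longleftrightarrow>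
      (\<forall>H\<in>proper_cyclic_subgroups G. \<forall>K\<in>proper_cyclic_subgroups G.
        H \<noteq> K \<longrightarrow> H \<inter> K \<noteq> {\<one>\<^bsub>G\<^esub>})"
    by (auto simp: proper_cyclic_subgroups_def)
  then show ?thesis
    unfolding digraph_iso_triangle_iff[OF pair_graph_cyclic_intersection_graph[OF assms(2)]]
    by (simp add: cyclic_intersection_graph_def)
qed

lemma (in group) cyclic_group_triangle_iff:
  assumes fin: "finite (carrier G)" and cyc: "cyclic_group G"
  shows "digraph_iso (with_proj (cyclic_intersection_graph G)) (with_proj (cycle_graph 3)) \<longleftrightarrow>
    (\<exists>p. prime p \<and> order G = p ^ 4)"
proof -
  define D where "D = {d. d dvd order G \<and> d \<noteq> 1 \<and> d \<noteq> order G}"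
  have pos: "order G > 0" using fin order_gt_0_iff_finite by blast
  have V: "proper_cyclic_subgroups G = torsion G ` D"
    using proper_cyclic_subgroups_eq_torsion[OF fin cyc] by (simp add: D_def)
  have "card (torsion G ` D) = card D"
    by (rule card_image) (auto simp: inj_on_def D_def torsion_eq_iff[OF fin cyc])
  moreover have "torsion G d \<inter> torsion G e = {\<one>} \<longleftrightarrow> coprime d e" if "d \<in> D" "e \<in> D" for d e
  proof -
    have "gcd d e dvd order G" using that by (auto simp: D_def intro: dvd_trans[OF gcd_dvd1])
    then have "torsion G (gcd d e) = torsion G 1 \<longleftrightarrow> gcd d e = 1"
      by (rule torsion_eq_iff[OF fin cyc]) simp
    then show ?thesis by (simp add: torsion_Int torsion_1[symmetric] coprime_iff_gcd_eq_1 del: One_nat_def)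
  qed
  ultimately show ?thesis
    unfolding cyclic_intersection_graph_triangle_iff[OF is_group fin] V
    using three_proper_divisors_iff[OF pos] by (simp add: D_def)
qed

lemma (in group) clique_neighbourhood_of_minimal_vertex:
  assumes P: "P \<in> proper_cyclic_subgroups G"
    and min: "\<And>H. H \<in> proper_cyclic_subgroups G \<Longrightarrow> H \<subseteq> P \<Longrightarrow> H = P"
    and H: "(P, H) \<in> parcs (cyclic_intersection_graph G)"
    and K: "(P, K) \<in> parcs (cyclic_intersection_graph G)" and "H \<noteq> K"
  shows "(H, K) \<in> parcs (cyclic_intersection_graph G)"
proof -
  have "P \<subseteq> H" "P \<subseteq> K"
    using minimal_proper_cyclic_subgroup_subset[OF P _ min] H K
    by (auto simp: cyclic_intersection_graph_def)
  moreover have "P \<noteq> {\<one>}" "\<one> \<in> P"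
    using P subgroup.one_closed by (auto simp: proper_cyclic_subgroups_def)
  ultimately show ?thesis
    using H K \<open>H \<noteq> K\<close> by (auto simp: cyclic_intersection_graph_def)
qed

theorem theorem2p7:
  fixes G :: "('a, 'b) monoid_scheme" and n :: nat
  assumes "group G" and "finite (carrier G)" and "n \<ge> 3"
  shows "digraph_iso (with_proj (cyclic_intersection_graph G)) (with_proj (cycle_graph n)) \<longleftrightarrow>
    n = 3 \<and> (\<exists>p :: nat. prime p \<and> G \<cong> integer_mod_group (p ^ 4))"
proof -
  interpret group G by fact
  interpret I: pair_graph "cyclic_intersection_graph G"
    by (rule pair_graph_cyclic_intersection_graph) fact
  interpret C: pair_graph "cycle_graph n"
    by (rule pair_graph_cycle_graph) fact
  let ?V = "proper_cyclic_subgroups G"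
  have "(\<exists>p :: nat. prime p \<and> G \<cong> integer_mod_group (p ^ 4)) \<longleftrightarrow>
      cyclic_group G \<and> (\<exists>p :: nat. prime p \<and> order G = p ^ 4)"
    using iso_integer_mod_group_iff[OF assms(1,2)] by (metis prime_gt_0_nat zero_less_power)
  moreover have "n = 3 \<and> cyclic_group G"
    if iso: "digraph_iso (with_proj (cyclic_intersection_graph G)) (with_proj (cycle_graph n))"
  proof -
    have verts: "pverts (cyclic_intersection_graph G) = ?V" "pverts (cycle_graph n) = {..<n}"
      by (simp_all add: cyclic_intersection_graph_def cycle_graph_def)
    obtain f where f: "bij_betw f ?V {..<n}"
      and adj: "\<forall>H\<in>?V. \<forall>K\<in>?V.
        (H, K) \<in> parcs (cyclic_intersection_graph G) \<longleftrightarrow> (f H, f K) \<in> parcs (cycle_graph n)"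
      using iso digraph_iso_with_proj_iff[OF I.pair_wf_digraph_axioms C.pair_wf_digraph_axioms]
      unfolding verts by blast
    have "finite ?V" using I.pair_finite_verts verts by simp
    moreover have "?V \<noteq> {}" using bij_betw_same_card[OF f] assms(3) by auto
    ultimately obtain P where P: "P \<in> ?V" and min: "\<And>H. H \<in> ?V \<Longrightarrow> H \<subseteq> P \<Longrightarrow> H = P"
      using finite_has_minimal[of ?V] by metis
    have n: "n = 3"
    proof (rule cycle_graph_clique_neighbourhood[OF assms(3)])
      show "f P < n" using f P by (auto simp: bij_betw_def)
      fix i j assume ij: "(f P, i) \<in> parcs (cycle_graph n)" "(f P, j) \<in> parcs (cycle_graph n)" "i \<noteq> j"
      then have "i \<in> f ` ?V" "j \<in> f ` ?V"
        using f C.in_arcsD2 verts by (metis bij_betw_def)+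
      then obtain H K where HK: "H \<in> ?V" "K \<in> ?V" "i = f H" "j = f K" by blast
      then show "(i, j) \<in> parcs (cycle_graph n)"
        using clique_neighbourhood_of_minimal_vertex[OF P min, of H K] adj ij P by blast
    qed
    have triangle: "card ?V = 3" "\<forall>H\<in>?V. \<forall>K\<in>?V. H \<inter> K \<noteq> {\<one>\<^bsub>G\<^esub>}"
      using iso n cyclic_intersection_graph_triangle_iff[OF assms(1,2)] by auto
    have "P \<subseteq> H" if "H \<in> ?V" for H
      using minimal_proper_cyclic_subgroup_subset[OF P that min] triangle(2) P that by blast
    then have "cyclic_group G"
      using cyclic_group_if_three_proper_cyclic_subgroups[OF triangle(1) P] by blast
    with n show ?thesis by blast
  qed
  ultimately show ?thesis
    using cyclic_group_triangle_iff[OF assms(2)] by blast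
qed

end
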